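(* Let $T$ be a terrain with vertex set $V$, let $$U := V \cup \bigcup_{v \in V} \{ p \mid p \text{ is extremal in } \mathcal{V}(v) \},$$ and let $W(U) = \{ w_f \mid f \in F,\ G(f) \text{ is inclusion-minimal} \}$, where $F$ is the set of features of the visibility overlay of $U$, $G(f) = \{ g \in U \mid f \subseteq \mathcal{V}(g)\}$, and $w_f$ is an arbitrary point of $f$. If $C$ is an optimal solution of $\operatorname{TGP}(U, W(U))$, i.e., $|C| = \operatorname{OPT}(U,W(U))$, then $C$ is also an optimal solution of $\operatorname{TGP}(T,T)$, i.e., $\operatorname{OPT}(T,T) = |C| = \operatorname{OPT}(U,W(U))$.
   Context: A terrain $T$ is an $x$-monotone polygonal chain in the plane with vertices $V = \{v_1,\dots,v_n\}$ (in order of strictly increasing $x$-coordinate) and edges $e_i = \overline{v_i v_{i+1}}$. A point $p \in T$ sees (covers) $q \in T$ iff the segment $\overline{pq}$ is nowhere below $T$. The visibility region of $p \in T$ is $\mathcal{V}(p) = \{ q \in T \mid p \text{ sees } q\}$, and $\mathcal{V}(G) = \bigcup_{g\in G}\mathcal{V}(g)$ for $G \subseteq T$. A point $q \in \mathcal{V}(p)$ is extremal in $\mathcal{V}(p)$ if it has maximal or minimal $x$-coordinate within its connected component of $\mathcal{V}(p)$. Terrain Guarding Problem $\operatorname{TGP}(G,W)$: given $G, W \subseteq T$ with $W \subseteq \mathcal{V}(G)$, find a minimum-cardinality set $G^* \subseteq G$ with $W \subseteq \mathcal{V}(G^* )$. A feasible solution is any $C \subseteq G$ with $W \subseteq \mathcal{V}(C)$;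 an optimal solution is a feasible one of minimum cardinality, and $\operatorname{OPT}(G,W)$ denotes this minimum cardinality. Visibility overlay of a finite set $G \subset T$: each $\mathcal{V}(g)$, $g\in G$, is a finite union of disjoint closed subterrains (its connected components), viewed as closed (possibly degenerate) intervals via projection to the $x$-axis. The end points of all these intervals, over all $g \in G$, subdivide $T$; the features of the overlay are these end points (as single-point sets) and the maximal intervals (the open intervals between consecutive end points). All points of a feature are seen by the same guards of $G$. "Inclusion-minimal" means that no feature $f'\in F$ has $G(f') \subsetneq G(f)$. *)

theory Defs
  imports "HOL-Analysis.Analysis"
begin

type_synonym point = "real \<times> real"

text \<open>
  A terrain is given by the list of its vertices in order of strictly increasing x-coordinate.
\<close>

definition is_terrain :: "point list \<Rightarrow> bool" where
  "is_terrain vs \<longleftrightarrow> vs \<noteq> [] \<and> sorted_wrt (\<lambda>p q. fst p < fst q) vs"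

text \<open>
  The union with \<open>set vs\<close> only matters for a chain with a single vertex, which has no edges.
\<close>

definition terrain :: "point list \<Rightarrow> point set" where
  "terrain vs = set vs \<union> (\<Union>i\<in>{i. Suc i < length vs}. closed_segment (vs ! i) (vs ! Suc i))"

definition sees :: "point list \<Rightarrow> point \<Rightarrow> point \<Rightarrow> bool" where
  "sees vs p q \<longleftrightarrow> p \<in> terrain vs \<and> q \<in> terrain vs \<and>
     (\<forall>z\<in>closed_segment p q. \<forall>t\<in>terrain vs. fst t = fst z \<longrightarrow> snd t \<le> snd z)"

definition vis :: "point list \<Rightarrow> point \<Rightarrow> point set" where
  "vis vs p = {q \<in> terrain vs. sees vs p q}"

definition vis_set :: "point list \<Rightarrow> point set \<Rightarrow> point set" where
  "vis_set vs G = (\<Union>g\<in>G. vis vs g)"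

definition extremal :: "point list \<Rightarrow> point \<Rightarrow> point \<Rightarrow> bool" where
  "extremal vs p q \<longleftrightarrow> q \<in> vis vs p \<and>
     ((\<forall>r\<in>connected_component_set (vis vs p) q. fst r \<le> fst q) \<or>
      (\<forall>r\<in>connected_component_set (vis vs p) q. fst q \<le> fst r))"

definition feasible :: "point list \<Rightarrow> point set \<Rightarrow> point set \<Rightarrow> point set \<Rightarrow> bool" where
  "feasible vs G W C \<longleftrightarrow> C \<subseteq> G \<and> W \<subseteq> vis_set vs C"

text \<open>
  Since \<open>card\<close> is 0 on infinite sets, the minimum ranges over the finite feasible solutions.
  It is a genuine minimum only if a finite feasible solution exists; this is why \<open>optimal\<close>
  demands feasibility and finiteness separately.
\<close>

definition OPT :: "point list \<Rightarrow> point set \<Rightarrow> point set \<Rightarrow> nat" where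
  "OPT vs G W = (LEAST k. \<exists>C. feasible vs G W C \<and> finite C \<and> card C = k)"

definition optimal :: "point list \<Rightarrow> point set \<Rightarrow> point set \<Rightarrow> point set \<Rightarrow> bool" where
  "optimal vs G W C \<longleftrightarrow> feasible vs G W C \<and> finite C \<and> card C = OPT vs G W"

definition guards_U :: "point list \<Rightarrow> point set" where
  "guards_U vs = set vs \<union> (\<Union>v\<in>set vs. {p. extremal vs v p})"

text \<open>
  The end points of the connected components of a visibility region, seen as intervals on the
  x-axis, are exactly its extremal points.
\<close>

definition overlay_endpoints :: "point list \<Rightarrow> point set \<Rightarrow> point set" where
  "overlay_endpoints vs G = (\<Union>g\<in>G. {p. extremal vs g p})"

definition open_subterrain :: "point list \<Rightarrow> point \<Rightarrow> point \<Rightarrow> point set" where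
  "open_subterrain vs p q = {r \<in> terrain vs. fst p < fst r \<and> fst r < fst q}"

definition features :: "point list \<Rightarrow> point set \<Rightarrow> point set set" where
  "features vs G =
     {{p} | p. p \<in> overlay_endpoints vs G} \<union>
     {open_subterrain vs p q | p q.
        p \<in> overlay_endpoints vs G \<and> q \<in> overlay_endpoints vs G \<and> fst p < fst q \<and>
        \<not> (\<exists>s\<in>overlay_endpoints vs G. fst p < fst s \<and> fst s < fst q)}"

definition feature_guards :: "point list \<Rightarrow> point set \<Rightarrow> point set \<Rightarrow> point set" where
  "feature_guards vs G f = {g \<in> G. f \<subseteq> vis vs g}"

definition minimal_features :: "point list \<Rightarrow> point set \<Rightarrow> point set set" where
  "minimal_features vs G =
     {f \<in> features vs G.
        \<not> (\<exists>f'\<in>features vs G. feature_guards vs G f' \<subset> feature_guards vs G f)}"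

definition witnesses :: "point list \<Rightarrow> point set \<Rightarrow> (point set \<Rightarrow> point) \<Rightarrow> point set" where
  "witnesses vs G w = {w f | f. f \<in> minimal_features vs G}"

end

theory Submission
  imports Defs
begin

text \<open>
  A guard \<open>g\<close> of a cover of the terrain that is not in \<open>U\<close> lies inside an edge. Sliding it along
  this edge to the right preserves what it sees on the left, and conversely; sliding it to its left
  neighbour in \<open>U\<close> keeps all vertices visible. If neither slide keeps the cover intact, there are
  points \<open>p\<close> on the left and \<open>y\<close> on the right that need \<open>g\<close>. Then \<open>g\<close> sees only a part of the edge
  of \<open>p\<close>, and the guard that covers a point of this edge just beyond that part is to the left of
  the edge, so high up that it sees \<open>y\<close> as well: a contradiction. So \<open>U\<close> contains an optimal cover.
  Conversely, a guard in \<open>U\<close> that sees a point of a feature sees the whole feature, and the guards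
  of each feature include those of a minimal one, so covering \<open>W(U)\<close> by \<open>U\<close> covers the terrain.
\<close>

section \<open>Comparison of affine functions between and beyond two given points\<close>

lemma line_le_between:
  fixes m k m' k' x y z :: real
  assumes "m * x + k \<le> m' * x + k'" "m * y + k \<le> m' * y + k'" "x \<le> z" "z \<le> y"
  shows "m * z + k \<le> m' * z + k'"
proof (cases "m \<le> m'")
  case True
  then have "(m' - m) * x \<le> (m' - m) * z" using assms by (intro mult_left_mono) auto
  then show ?thesis using assms by (simp add: algebra_simps)
next
  case False
  then have "(m - m') * z \<le> (m - m') * y" using assms by (intro mult_left_mono) auto
  then show ?thesis using assms by (simp add: algebra_simps)
qed

text \<open>The order of the two lines switches between \<open>x\<close> and \<open>y\<close>, which
  forces \<open>m \<le> m'\<close>; so the order at \<open>y\<close> persists further right.\<close>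

lemma line_le_right:
  fixes m k m' k' x y z :: real
  assumes "m' * x + k' \<le> m * x + k" "m * y + k \<le> m' * y + k'" "x < y" "y \<le> z"
  shows "m * z + k \<le> m' * z + k'"
proof -
  have "0 \<le> (m' - m) * (y - x)" using assms by (simp add: algebra_simps)
  then have "m \<le> m'" using assms(3) by (simp add: zero_le_mult_iff)
  then have "(m' - m) * y \<le> (m' - m) * z" using assms by (intro mult_left_mono) auto
  then show ?thesis using assms by (simp add: algebra_simps)
qed

lemma line_le_left:
  fixes m k m' k' x y z :: real
  assumes "m * x + k \<le> m' * x + k'" "m' * y + k' \<le> m * y + k" "x < y" "z \<le> x"
  shows "m * z + k \<le> m' * z + k'"
  using line_le_right[of "-m'" "-y" k' "-m" k "-x" "-z"] assms by simp

lemma line_through: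
  fixes x y u v :: real
  assumes "x < y"
  obtains m k where "m * x + k = u" "m * y + k = v"
proof
  show "(v - u) / (y - x) * x + (u - (v - u) / (y - x) * x) = u" by simp
  have "(v - u) / (y - x) * y + (u - (v - u) / (y - x) * x) = u + (v - u) / (y - x) * (y - x)"
    by (simp only: algebra_simps)
  then show "(v - u) / (y - x) * y + (u - (v - u) / (y - x) * x) = v" using assms by simp
qed

section \<open>Lines of sight over the graph of a function\<close>

text \<open>The parametrized chord presupposes no order of \<open>x\<close> and \<open>y\<close> and
  allows \<open>x = y\<close>. \<open>los_lineI\<close> and \<open>los_lineE\<close> translate to a
  chord given by slope and intercept, to which the comparison lemmas apply.\<close>

definition los :: "(real \<Rightarrow> real) \<Rightarrow> real \<Rightarrow> real \<Rightarrow> bool" where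
  "los F x y \<longleftrightarrow> (\<forall>t\<in>{0..1}. F ((1 - t) * x + t * y) \<le> (1 - t) * F x + t * F y)"

lemma los_sym: "los F x y \<Longrightarrow> los F y x"
  unfolding los_def
proof
  fix t :: real
  assume *: "\<forall>t\<in>{0..1}. F ((1 - t) * x + t * y) \<le> (1 - t) * F x + t * F y" and t: "t \<in> {0..1}"
  show "F ((1 - t) * y + t * x) \<le> (1 - t) * F y + t * F x"
    using *[rule_format, of "1 - t"] t by (simp add: add.commute)
qed

lemma los_commute: "los F x y \<longleftrightarrow> los F y x"
  using los_sym by blast

lemma los_refl: "los F x x"
  by (simp add: los_def algebra_simps)

lemma los_reflect: "los (\<lambda>x. F (- x)) (- x) (- y) \<longleftrightarrow> los F x y"
proof -
  have "- ((1 - t) * - x + t * - y) = (1 - t) * x + t * y" for t :: real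
    by (simp add: algebra_simps)
  then show ?thesis unfolding los_def by (simp only: minus_minus)
qed

lemma los_lineI:
  assumes "m * x + k = F x" "m * y + k = F y" "x \<le> y" "\<And>z. x \<le> z \<Longrightarrow> z \<le> y \<Longrightarrow> F z \<le> m * z + k"
  shows "los F x y"
  unfolding los_def
proof
  fix t :: real
  assume "t \<in> {0..1}"
  then have "0 \<le> t * (y - x)" "t * (y - x) \<le> 1 * (y - x)"
    using assms(3) by (intro mult_nonneg_nonneg mult_right_mono; simp)+
  then have "F ((1 - t) * x + t * y) \<le> m * ((1 - t) * x + t * y) + k"
    by (intro assms(4)) (auto simp: algebra_simps)
  also have "\<dots> = (1 - t) * (m * x + k) + t * (m * y + k)" by (simp add: algebra_simps)
  finally show "F ((1 - t) * x + t * y) \<le> (1 - t) * F x + t * F y" using assms by simp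
qed

lemma los_lineE:
  assumes "los F x y" "x < y"
  obtains m k where "m * x + k = F x" "m * y + k = F y" "\<And>z. x \<le> z \<Longrightarrow> z \<le> y \<Longrightarrow> F z \<le> m * z + k"
proof -
  obtain m k where mk: "m * x + k = F x" "m * y + k = F y" using line_through[OF assms(2)] by metis
  have "F z \<le> m * z + k" if z: "x \<le> z" "z \<le> y" for z
  proof -
    define t where "t = (z - x) / (y - x)"
    have t: "t \<in> {0..1}" using z assms(2) by (auto simp: t_def)
    have "t * (y - x) = z - x" using assms(2) by (simp add: t_def)
    then have zt: "(1 - t) * x + t * y = z" by (simp add: algebra_simps)
    have "F z \<le> (1 - t) * (m * x + k) + t * (m * y + k)"
      using assms(1) t unfolding los_def mk zt[symmetric] by blast
    also have "\<dots> = m * ((1 - t) * x + t * y) + k" by (simp add: algebra_simps)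
    finally show ?thesis by (simp add: zt)
  qed
  with mk that show thesis by blast
qed

section \<open>Visibility of and along a single edge\<close>

definition affine_between :: "(real \<Rightarrow> real) \<Rightarrow> real \<Rightarrow> real \<Rightarrow> bool" where
  "affine_between F l r \<longleftrightarrow> (\<exists>m k. \<forall>z\<in>{l..r}. F z = m * z + k)"

lemma affine_between_reflect:
  assumes "affine_between F l r"
  shows "affine_between (\<lambda>x. F (- x)) (- r) (- l)"
proof -
  obtain m k where "\<And>z. l \<le> z \<Longrightarrow> z \<le> r \<Longrightarrow> F z = m * z + k" using assms unfolding affine_between_def by auto
  then have "\<forall>z\<in>{- r..- l}. F (- z) = (- m) * z + k" by auto
  then show ?thesis unfolding affine_between_def by blast
qed

lemma los_same_edge:
  assumes "affine_between F l r" "l \<le> x" "x \<le> r" "l \<le> y" "y \<le> r"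
  shows "los F x y"
proof -
  obtain m k where e: "\<And>z. l \<le> z \<Longrightarrow> z \<le> r \<Longrightarrow> F z = m * z + k" using assms(1) unfolding affine_between_def by auto
  have "los F x y" if "x \<le> y" "l \<le> x" "y \<le> r" for x y
    using that by (intro los_lineI[of m x k]) (auto simp: e)
  then show ?thesis using assms los_sym by (meson linear)
qed

text \<open>Since the sight line from \<open>p1\<close> passes above \<open>p2\<close>, the line of
  the edge passes at or below \<open>g\<close>. The chord from \<open>p\<close> to \<open>g\<close>
  therefore lies above the edge as far as \<open>p2\<close>, and above the chord from
  \<open>p2\<close> to \<open>g\<close> from there on.\<close>

lemma los_triangle:
  assumes "affine_between F p1 p2" "p1 \<le> p" "p \<le> p2" "p2 \<le> g" "los F p1 g" "los F p2 g"
  shows "los F p g"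
proof (cases "p1 = p \<or> p = p2")
  case True
  then show ?thesis using assms by auto
next
  case False
  obtain m k where e: "\<And>z. p1 \<le> z \<Longrightarrow> z \<le> p2 \<Longrightarrow> F z = m * z + k" using assms(1) unfolding affine_between_def by auto
  have lt: "p1 < p" "p < p2" "p1 < g" "p < g" using False assms by auto
  obtain m1 k1 where 1: "m1 * p1 + k1 = F p1" "m1 * g + k1 = F g"
    "\<And>z. p1 \<le> z \<Longrightarrow> z \<le> g \<Longrightarrow> F z \<le> m1 * z + k1"
    using los_lineE[OF assms(5) lt(3)] by metis
  obtain m3 k3 where 3: "m3 * p + k3 = F p" "m3 * g + k3 = F g" using line_through[OF lt(4)] by metis
  have ev: "F p1 = m * p1 + k" "F p = m * p + k" "F p2 = m * p2 + k" using assms by (auto intro!: e)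
  have "m * g + k \<le> m1 * g + k1"
    by (rule line_le_right[of m1 p1 k1 m k p2]; use 1 ev 1(3)[of p2] lt assms in linarith)
  then have eg: "m * g + k \<le> F g" using 1 by simp
  have e3: "m * z + k \<le> m3 * z + k3" if "p \<le> z" "z \<le> g" for z
    by (rule line_le_between[of m p k m3 k3 g]; use ev 3 eg that lt in linarith)
  show ?thesis
  proof (cases "p2 = g")
    case True
    then show ?thesis by (intro los_lineI[OF 3]) (use e3 e lt in auto)
  next
    case False
    then have lt2: "p2 < g" using assms by simp
    obtain m2 k2 where 2: "m2 * p2 + k2 = F p2" "m2 * g + k2 = F g"
      "\<And>z. p2 \<le> z \<Longrightarrow> z \<le> g \<Longrightarrow> F z \<le> m2 * z + k2"
      using los_lineE[OF assms(6) lt2] by metis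
    show ?thesis
    proof (intro los_lineI[OF 3])
      fix z assume z: "p \<le> z" "z \<le> g"
      show "F z \<le> m3 * z + k3"
      proof (cases "z \<le> p2")
        case True
        then show ?thesis using e[of z] e3[of z] z lt by simp
      next
        case False
        have "m2 * z + k2 \<le> m3 * z + k3"
          by (rule line_le_between[of m2 p2 k2 m3 k3 g]; use ev e3[of p2] 2(1,2) 3 z False lt lt2 in linarith)
        then show ?thesis using 2(3)[of z] z False by simp
      qed
    qed (use lt in auto)
  qed
qed

text \<open>The sight line from \<open>p\<close> passes above \<open>r\<close>, and
  \<open>p < r\<close>, so the line of the edge passes at or below \<open>g\<close>. The chord from
  \<open>p'\<close> then stays above the edge up to \<open>p\<close> and above the old sight line
  after \<open>p\<close>.\<close>

lemma los_extend:
  assumes "affine_between F l r" "l \<le> p'" "p' \<le> p" "p < r" "r \<le> g" "los F p g"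
  shows "los F p' g"
proof -
  obtain m k where e: "\<And>z. l \<le> z \<Longrightarrow> z \<le> r \<Longrightarrow> F z = m * z + k" using assms(1) unfolding affine_between_def by auto
  have lt: "p < g" "p' < g" using assms by auto
  obtain m1 k1 where 1: "m1 * p + k1 = F p" "m1 * g + k1 = F g"
    "\<And>z. p \<le> z \<Longrightarrow> z \<le> g \<Longrightarrow> F z \<le> m1 * z + k1"
    using los_lineE[OF assms(6) lt(1)] by metis
  obtain m3 k3 where 3: "m3 * p' + k3 = F p'" "m3 * g + k3 = F g" using line_through[OF lt(2)] by metis
  have ev: "F p' = m * p' + k" "F p = m * p + k" "F r = m * r + k" using assms by (auto intro!: e)
  have eg: "m * g + k \<le> m1 * g + k1"
    by (rule line_le_right[of m1 p k1 m k r]; use 1(1,2) ev 1(3)[of r] lt assms in linarith)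
  have e3: "m * z + k \<le> m3 * z + k3" if "p' \<le> z" "z \<le> g" for z
    by (rule line_le_between[of m p' k m3 k3 g]; use ev 3 1(1,2) eg that lt assms in linarith)
  show ?thesis
  proof (intro los_lineI[OF 3])
    fix z assume z: "p' \<le> z" "z \<le> g"
    show "F z \<le> m3 * z + k3"
    proof (cases "z \<le> p")
      case True
      then show ?thesis using e[of z] e3[of z] z assms by simp
    next
      case False
      have "m1 * z + k1 \<le> m3 * z + k3"
        by (rule line_le_between[of m1 p k1 m3 k3 g]; use ev e3[of p] 1(1,2) 3 z False lt assms in linarith)
      then show ?thesis using 1(3)[of z] z False by simp
    qed
  qed (use lt in auto)
qed

text \<open>The sight line from \<open>p\<close> to \<open>g\<close> passes above \<open>l\<close>,
  so the line of the edge lies at or below it at \<open>p\<close> and at or above it at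
  \<open>u\<close>. Hence the chord from \<open>p\<close> to \<open>u\<close> dominates the old
  sight line up to \<open>g\<close> and the edge after \<open>g\<close>.\<close>

lemma los_slide_right:
  assumes "affine_between F l r" "p \<le> l" "l < g" "g \<le> u" "u \<le> r" "los F p g"
  shows "los F p u"
proof -
  obtain m k where e: "\<And>z. l \<le> z \<Longrightarrow> z \<le> r \<Longrightarrow> F z = m * z + k" using assms(1) unfolding affine_between_def by auto
  have lt: "p < g" "p < u" using assms by auto
  obtain m1 k1 where 1: "m1 * p + k1 = F p" "m1 * g + k1 = F g"
    "\<And>z. p \<le> z \<Longrightarrow> z \<le> g \<Longrightarrow> F z \<le> m1 * z + k1"
    using los_lineE[OF assms(6) lt(1)] by metis
  obtain m3 k3 where 3: "m3 * p + k3 = F p" "m3 * u + k3 = F u" using line_through[OF lt(2)] by metis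
  have ev: "F l = m * l + k" "F g = m * g + k" "F u = m * u + k" using assms by (auto intro!: e)
  have ep: "m * p + k \<le> m1 * p + k1"
    by (rule line_le_left[of m l k m1 k1 g]; use 1(1,2) 1(3)[of l] ev assms in linarith)
  have eu: "m1 * u + k1 \<le> m * u + k"
    by (rule line_le_right[of m l k m1 k1 g]; use 1(1,2) 1(3)[of l] ev assms in linarith)
  show ?thesis
  proof (intro los_lineI[OF 3])
    fix z assume z: "p \<le> z" "z \<le> u"
    show "F z \<le> m3 * z + k3"
    proof (cases "z \<le> g")
      case True
      have "m1 * z + k1 \<le> m3 * z + k3"
        by (rule line_le_between[of m1 p k1 m3 k3 u]; use 1(1,2) 3 eu ev z lt assms in linarith)
      then show ?thesis using 1(3)[of z] z True by simp
    next
      case False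
      have "m * z + k \<le> m3 * z + k3"
        by (rule line_le_between[of m p k m3 k3 u]; use 1(1,2) 3 ep ev z lt assms in linarith)
      then show ?thesis using e[of z] z False assms by simp
    qed
  qed (use lt in auto)
qed

lemma los_slide_left:
  assumes "affine_between F l r" "r \<le> p" "g < r" "u \<le> g" "l \<le> u" "los F p g"
  shows "los F p u"
  using los_slide_right[OF affine_between_reflect[OF assms(1)], of "- p" "- g" "- u"] assms
  by (simp add: los_reflect)

text \<open>
  The lines through \<open>c, q\<close>, through \<open>p, g\<close> and through \<open>g, y\<close> have increasing slopes: the edge
  containing \<open>p, q\<close> separates the first two, the edge containing \<open>g\<close> the last two. So their
  maximum is a convex function above the terrain, and the chord from \<open>c\<close> to \<open>y\<close> lies above it.
\<close>

lemma los_bridge: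
  assumes "affine_between F l r" "affine_between F l' r'"
    and "c \<le> l" "l \<le> p" "p < q" "q \<le> r" "r \<le> l'" "l' < g" "g < r'" "r' \<le> y"
    and "los F c q" "los F p g" "los F g y"
  shows "los F c y"
proof -
  obtain m k where e: "\<And>z. l \<le> z \<Longrightarrow> z \<le> r \<Longrightarrow> F z = m * z + k" using assms(1) unfolding affine_between_def by auto
  obtain m' k' where e': "\<And>z. l' \<le> z \<Longrightarrow> z \<le> r' \<Longrightarrow> F z = m' * z + k'" using assms(2) unfolding affine_between_def by auto
  have lt: "c < q" "p < g" "g < y" "c < y" using assms by auto
  obtain m1 k1 where 1: "m1 * c + k1 = F c" "m1 * q + k1 = F q"
    "\<And>z. c \<le> z \<Longrightarrow> z \<le> q \<Longrightarrow> F z \<le> m1 * z + k1"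
    using los_lineE[OF assms(11) lt(1)] by metis
  obtain m2 k2 where 2: "m2 * p + k2 = F p" "m2 * g + k2 = F g"
    "\<And>z. p \<le> z \<Longrightarrow> z \<le> g \<Longrightarrow> F z \<le> m2 * z + k2"
    using los_lineE[OF assms(12) lt(2)] by metis
  obtain m3 k3 where 3: "m3 * g + k3 = F g" "m3 * y + k3 = F y"
    "\<And>z. g \<le> z \<Longrightarrow> z \<le> y \<Longrightarrow> F z \<le> m3 * z + k3"
    using los_lineE[OF assms(13) lt(3)] by metis
  obtain m4 k4 where 4: "m4 * c + k4 = F c" "m4 * y + k4 = F y" using line_through[OF lt(4)] by metis
  have "F l = m * l + k" "F p = m * p + k" "F q = m * q + k" "F r = m * r + k"
    "F l' = m' * l' + k'" "F g = m' * g + k'" "F r' = m' * r' + k'"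
    "F l \<le> m1 * l + k1" "F r \<le> m2 * r + k2" "F l' \<le> m2 * l' + k2" "F r' \<le> m3 * r' + k3"
    using assms(3-10) by (auto intro!: e e' 1(3) 2(3) 3(3))
  note facts = this 1(1,2) 2(1,2) 3(1,2) assms(3-10)
  \<comment> \<open>At \<open>c\<close> the lines with slopes \<open>m1\<close>, \<open>m\<close>,
    \<open>m2\<close>, \<open>m'\<close>, \<open>m3\<close> have weakly decreasing values in this
    order, at \<open>y\<close> weakly increasing ones. The chord agrees with the first line at
    \<open>c\<close> and with the last at \<open>y\<close>, so it dominates the three sight lines at
    both ends.\<close>
  have c1: "m * c + k \<le> m1 * c + k1" by (rule line_le_left[of m l k m1 k1 q]; use facts in linarith)
  have c2: "m2 * c + k2 \<le> m * c + k" by (rule line_le_left[of m2 p k2 m k r]; use facts in linarith)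
  have c3: "m' * c + k' \<le> m2 * c + k2" by (rule line_le_left[of m' l' k' m2 k2 g]; use facts in linarith)
  have c4: "m3 * c + k3 \<le> m' * c + k'" by (rule line_le_left[of m3 g k3 m' k' r']; use facts in linarith)
  have y1: "m1 * y + k1 \<le> m * y + k" by (rule line_le_right[of m l k m1 k1 q]; use facts in linarith)
  have y2: "m * y + k \<le> m2 * y + k2" by (rule line_le_right[of m2 p k2 m k r]; use facts in linarith)
  have y3: "m2 * y + k2 \<le> m' * y + k'" by (rule line_le_right[of m' l' k' m2 k2 g]; use facts in linarith)
  have y4: "m' * y + k' \<le> m3 * y + k3" by (rule line_le_right[of m3 g k3 m' k' r']; use facts in linarith)
  show ?thesis
  proof (intro los_lineI[OF 4])
    fix z assume z: "c \<le> z" "z \<le> y"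
    have "m1 * z + k1 \<le> m4 * z + k4"
      by (rule line_le_between[of m1 c k1 m4 k4 y]; use 1 3 4 y1 y2 y3 y4 z in linarith)
    moreover have "m2 * z + k2 \<le> m4 * z + k4"
      by (rule line_le_between[of m2 c k2 m4 k4 y]; use 1 3 4 c1 c2 y3 y4 z in linarith)
    moreover have "m3 * z + k3 \<le> m4 * z + k4"
      by (rule line_le_between[of m3 c k3 m4 k4 y]; use 1 3 4 c1 c2 c3 c4 z in linarith)
    ultimately show "F z \<le> m4 * z + k4"
      using 1(3)[of z] 2(3)[of z] 3(3)[of z] z assms(3-10) by linarith
  qed (use lt in auto)
qed

section \<open>Exchanging a guard inside an edge\<close>

text \<open>The set \<open>V\<close> holds the abscissas of the vertices. An edge is demanded only
  around points outside \<open>V\<close>, so that a single vertex with \<open>a = b\<close> is an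
  instance. The last clause of \<open>edge_exists\<close> makes \<open>l\<close> and
  \<open>r\<close> neighbours in \<open>V\<close>.\<close>

locale piecewise_affine =
  fixes F :: "real \<Rightarrow> real" and V :: "real set" and a b :: real
  assumes continuous: "continuous_on {a..b} F"
    and edge_exists: "\<And>x. x \<in> {a..b} \<Longrightarrow> x \<notin> V \<Longrightarrow>
      \<exists>l\<in>V. \<exists>r\<in>V. l < x \<and> x < r \<and> affine_between F l r \<and> (\<forall>v\<in>V. v \<le> l \<or> r \<le> v)"
    and V_subset: "V \<subseteq> {a..b}"
    and ends: "a \<in> V" "b \<in> V"
begin

lemma closed_los:
  assumes "g \<in> {a..b}"
  shows "closed {q \<in> {a..b}. los F g q}"
proof -
  have "closed {q \<in> {a..b}. F ((1 - t) * g + t * q) \<le> (1 - t) * F g + t * F q}"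
    if t: "t \<in> {0..1}" for t
  proof (rule continuous_on_closed_Collect_le)
    have "(1 - t) * g + t * q \<in> {a..b}" if "q \<in> {a..b}" for q
      using convexD[of "{a..b}" g q "1 - t" t] assms t that by auto
    then show "continuous_on {a..b} (\<lambda>q. F ((1 - t) * g + t * q))"
      by (intro continuous_on_compose2[OF continuous, of "{a..b}"] continuous_intros) auto
    show "continuous_on {a..b} (\<lambda>q. (1 - t) * F g + t * F q)"
      by (intro continuous_on_add continuous_on_mult continuous continuous_on_const)
  qed simp
  then have "closed (\<Inter>t\<in>{0..1}. {q \<in> {a..b}. F ((1 - t) * g + t * q) \<le> (1 - t) * F g + t * F q})"
    by blast
  moreover have "{q \<in> {a..b}. los F g q} =
    (\<Inter>t\<in>{0..1}. {q \<in> {a..b}. F ((1 - t) * g + t * q) \<le> (1 - t) * F g + t * F q})"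
    by (fastforce simp: los_def)
  ultimately show ?thesis by simp
qed

text \<open>The targets play different roles: \<open>ur\<close> may be any point of the edge from
  \<open>g\<close> on to the right, whereas \<open>ul\<close> has to stay visible from every vertex
  that sees \<open>g\<close>. This controls the lost point \<open>p\<close> through the end points
  of its edge.\<close>

lemma guard_shift:
  assumes C: "\<And>x. x \<in> {a..b} \<Longrightarrow> \<exists>c\<in>C. los F c x"
    and g: "g \<in> C" "l' < g" "g < r'" and edge: "l' \<in> V" "r' \<in> V" "affine_between F l' r'"
    and ul: "l' \<le> ul" "ul \<le> g" and ur: "g \<le> ur" "ur \<le> r'"
    and vert: "\<And>v. v \<in> V \<Longrightarrow> los F v g \<Longrightarrow> los F v ul"
  shows "(\<forall>x\<in>{a..b}. \<exists>c\<in>insert ul (C - {g}). los F c x) \<or>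
         (\<forall>x\<in>{a..b}. \<exists>c\<in>insert ur (C - {g}). los F c x)"
proof (rule ccontr)
  assume "\<not> ?thesis"
  then obtain p y where p: "p \<in> {a..b}" "\<And>c. c \<in> insert ul (C - {g}) \<Longrightarrow> \<not> los F c p"
    and y: "y \<in> {a..b}" "\<And>c. c \<in> insert ur (C - {g}) \<Longrightarrow> \<not> los F c y" by blast
  have gp: "los F g p" and gy: "los F g y" using C[OF p(1)] C[OF y(1)] p(2) y(2) by blast+
  have gI: "g \<in> {a..b}" using V_subset edge g by fastforce
  have np: "\<not> los F ul p" and ny: "\<not> los F ur y" using p y by blast+
  \<comment> \<open>The edge of \<open>g\<close> is seen entirely from \<open>ul\<close>, and a
    slide to the left keeps what \<open>g\<close> sees to the right of the edge; so only points to
    its left can be lost. The bound on \<open>y\<close> is the mirror image.\<close>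
  have "p < l'"
  proof (rule ccontr)
    assume "\<not> p < l'"
    then consider "p \<le> r'" "l' \<le> p" | "r' \<le> p" by linarith
    then show False
    proof cases
      case 1
      then show False using los_same_edge[OF edge(3), of ul p] np ul g by simp
    next
      case 2
      then show False using los_slide_left[OF edge(3), of p g ul] los_sym gp np ul g by blast
    qed
  qed
  have "r' < y"
  proof (rule ccontr)
    assume "\<not> r' < y"
    then consider "y \<le> r'" "l' \<le> y" | "y \<le> l'" by linarith
    then show False
    proof cases
      case 1
      then show False using los_same_edge[OF edge(3), of ur y] ny ur g by simp
    next
      case 2
      then show False using los_slide_right[OF edge(3), of y g ur] los_sym gy ny ur g by blast
    qed
  qed
  have "p \<notin> V" using vert[of p] gp np los_sym by blast
  then obtain l r where lr: "l \<in> V" "r \<in> V" "l < p" "p < r" "affine_between F l r"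
    "\<And>v. v \<in> V \<Longrightarrow> v \<le> l \<or> r \<le> v" using edge_exists[OF p(1)] by blast
  have "r \<le> l'" using lr(6)[OF edge(1)] lr(3) \<open>p < l'\<close> by linarith
  then have rg: "r \<le> g" "r \<le> ul" using g ul by auto
  have "los F l g" using los_extend[OF lr(5), of l p g] lr rg los_sym[OF gp] by simp
  then have ull: "los F l ul" using vert lr by blast
  \<comment> \<open>If \<open>g\<close> saw \<open>r\<close> as well, then \<open>ul\<close> would
    see both ends of the edge of \<open>p\<close>, hence \<open>p\<close> itself by
    \<open>los_triangle\<close>.\<close>
  have "\<not> los F r g"
  proof
    assume "los F r g"
    then have "los F r ul" using vert lr by blast
    then have "los F p ul" using los_triangle[OF lr(5), of p ul] ull lr rg by simp
    then show False using np los_sym by blast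
  qed
  \<comment> \<open>The set seen from \<open>g\<close> is closed, so if it contained the whole open
    interval from \<open>p\<close> to \<open>r\<close>, it would contain \<open>r\<close>.\<close>
  have "\<exists>q. p < q \<and> q < r \<and> \<not> los F g q"
  proof (rule ccontr)
    assume "\<nexists>q. p < q \<and> q < r \<and> \<not> los F g q"
    then have "{p<..<r} \<subseteq> {q \<in> {a..b}. los F g q}" using V_subset lr p by fastforce
    then have "closure {p<..<r} \<subseteq> {q \<in> {a..b}. los F g q}"
      using closed_los[OF gI] closure_minimal by blast
    then have "los F g r" using lr(4) by (auto simp: subset_eq)
    then show False using \<open>\<not> los F r g\<close> los_sym by blast
  qed
  then obtain q where q: "p < q" "q < r" "\<not> los F g q" by blast
  have "q \<in> {a..b}" using q p V_subset lr by fastforce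
  then obtain c where c: "c \<in> C" "los F c q" using C by blast
  have "c \<noteq> g" using c q by blast
  then have cC: "c \<in> C - {g}" using c by blast
  then have "\<not> los F c p" "\<not> los F c y" using p y by blast+
  \<comment> \<open>A guard on the edge of \<open>p\<close> sees \<open>p\<close> directly; one to
    the right of this edge that sees \<open>q\<close> also sees \<open>p\<close> by
    \<open>los_extend\<close>, because \<open>p\<close> is to the left of \<open>q\<close>. Both
    contradict the choice of \<open>p\<close>.\<close>
  have "c \<le> l"
  proof (rule ccontr)
    assume "\<not> c \<le> l"
    then consider "l \<le> c" "c \<le> r" | "r \<le> c" by linarith
    then have "los F c p"
    proof cases
      case 1
      then show ?thesis using los_same_edge[OF lr(5)] lr by simp
    next
      case 2
      then show ?thesis using los_extend[OF lr(5), of p q c] q lr c los_sym by (meson less_imp_le)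
    qed
    then show False using \<open>\<not> los F c p\<close> by blast
  qed
  then have "los F c y"
    using los_bridge[OF lr(5) edge(3), of c p q g y] lr q g \<open>r \<le> l'\<close> \<open>r' < y\<close> c gy los_sym[OF gp]
    by simp
  then show False using \<open>\<not> los F c y\<close> by blast
qed

end

section \<open>The terrain as the graph of a piecewise affine function\<close>

locale terrain_graph = piecewise_affine F "fst ` set vs" a b
  for F :: "real \<Rightarrow> real" and vs :: "point list" and a b :: real +
  assumes graph: "terrain vs = (\<lambda>x. (x, F x)) ` {a..b}"

lemma closed_segment_graph:
  fixes p q :: point
  assumes "fst p < fst q" "m * fst p + k = snd p" "m * fst q + k = snd q"
  shows "closed_segment p q = (\<lambda>x. (x, m * x + k)) ` {fst p..fst q}"
proof (intro set_eqI iffI)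
  fix z assume "z \<in> closed_segment p q"
  then obtain t where t: "0 \<le> t" "t \<le> 1" "z = (1 - t) *\<^sub>R p + t *\<^sub>R q"
    unfolding closed_segment_def by blast
  then have fz: "fst z = (1 - t) * fst p + t * fst q" and sz: "snd z = (1 - t) * snd p + t * snd q" by auto
  then have "snd z = m * fst z + k" unfolding assms(2,3)[symmetric] fz by (simp add: algebra_simps)
  moreover have "fst z \<in> closed_segment (fst p) (fst q)"
    unfolding closed_segment_def using fz t by auto
  then have "fst z \<in> {fst p..fst q}" using assms(1) by (simp add: closed_segment_eq_real_ivl)
  ultimately show "z \<in> (\<lambda>x. (x, m * x + k)) ` {fst p..fst q}" by (auto simp: image_iff prod_eq_iff)
next
  fix z assume "z \<in> (\<lambda>x. (x, m * x + k)) ` {fst p..fst q}"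
  then obtain x where x: "z = (x, m * x + k)" "x \<in> {fst p..fst q}" by blast
  then have "x \<in> closed_segment (fst p) (fst q)" using assms(1) by (simp add: closed_segment_eq_real_ivl)
  then obtain t where t: "0 \<le> t" "t \<le> 1" "x = (1 - t) * fst p + t * fst q"
    unfolding closed_segment_def by auto
  have "m * x + k = (1 - t) * snd p + t * snd q"
    unfolding assms(2,3)[symmetric] t(3) by (simp add: algebra_simps)
  then have "z = (1 - t) *\<^sub>R p + t *\<^sub>R q" using x(1) t(3) by (simp add: prod_eq_iff)
  then show "z \<in> closed_segment p q" unfolding closed_segment_def using t by blast
qed

lemma terrain_Cons: "terrain (p # q # vs) = closed_segment p q \<union> terrain (q # vs)"
proof -
  have "{i. Suc i < length (p # q # vs)} = insert 0 (Suc ` {i. Suc i < length (q # vs)})"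
    by (auto simp: image_iff) (metis Suc_less_eq not0_implies_Suc)
  then show ?thesis unfolding terrain_def by auto
qed

text \<open>By induction on the vertex list, the function of the remaining chain is extended to the
  left by the affine function through \<open>p\<close> and \<open>q\<close>. For a single vertex a
  constant function suffices, as the only abscissa is then that of the vertex.\<close>

lemma terrain_graph_exists:
  assumes "is_terrain vs"
  shows "\<exists>F. terrain_graph F vs (fst (hd vs)) (fst (last vs))"
proof -
  have "vs \<noteq> []" "sorted_wrt (\<lambda>p q. fst p < fst q) vs" using assms by (auto simp: is_terrain_def)
  then show ?thesis
  proof (induction vs rule: list_nonempty_induct)
    case (single p)
    have "terrain_graph (\<lambda>_. snd p) [p] (fst p) (fst p)"
      by unfold_locales (auto simp: terrain_def)
    then show ?case by auto
  next
    case (cons p ws)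
    then obtain q vs where ws: "ws = q # vs" by (cases ws) auto
    let ?b = "fst (last ws)"
    have sorted: "sorted_wrt (\<lambda>p q. fst p < fst q) ws" and pw: "\<And>v. v \<in> set ws \<Longrightarrow> fst p < fst v"
      using cons by auto
    obtain F where "terrain_graph F ws (fst q) ?b" using cons.IH[OF sorted] ws by auto
    then interpret F: terrain_graph F ws "fst q" ?b .
    have pq: "fst p < fst q" using pw ws by simp
    then obtain m k where mk: "m * fst p + k = snd p" "m * fst q + k = snd q"
      using line_through by metis
    define H where "H = (\<lambda>x. if x \<le> fst q then m * x + k else F x)"
    have "q \<in> terrain ws" using ws by (auto simp: terrain_def)
    then have Fq: "F (fst q) = snd q" unfolding F.graph by auto
    have qb: "fst q \<le> ?b" using F.V_subset ws by auto
    have H_right: "H x = F x" if "fst q \<le> x" for x using that Fq mk by (auto simp: H_def)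
    have H_left: "H x = m * x + k" if "x \<le> fst q" for x using that by (simp add: H_def)
    have un: "{fst p..?b} = {fst p..fst q} \<union> {fst q..?b}" using pq qb by auto
    have "terrain_graph H (p # ws) (fst p) ?b"
    proof
      have "continuous_on {fst p..fst q} H"
        by (rule continuous_on_eq[of _ "\<lambda>x. m * x + k"]) (auto intro!: continuous_intros simp: H_left)
      moreover have "continuous_on {fst q..?b} H"
        by (rule continuous_on_eq[OF F.continuous]) (auto simp: H_right)
      ultimately show "continuous_on {fst p..?b} H"
        unfolding un by (intro continuous_on_closed_Un) auto
      show "fst ` set (p # ws) \<subseteq> {fst p..?b}" using F.V_subset pq qb by auto
      show "fst p \<in> fst ` set (p # ws)" by simp
      show "?b \<in> fst ` set (p # ws)" using ws by simp
      have "(\<lambda>x. (x, H x)) ` {fst p..?b} =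
        (\<lambda>x. (x, m * x + k)) ` {fst p..fst q} \<union> (\<lambda>x. (x, F x)) ` {fst q..?b}"
        unfolding un image_Un by (intro arg_cong2[where f = "(\<union>)"] image_cong) (auto simp: H_left H_right)
      then show "terrain (p # ws) = (\<lambda>x. (x, H x)) ` {fst p..?b}"
        using terrain_Cons[of p q vs] closed_segment_graph[OF pq mk] F.graph ws by simp
      fix x assume x: "x \<in> {fst p..?b}" "x \<notin> fst ` set (p # ws)"
      then have "x \<noteq> fst p" "x \<noteq> fst q" using ws by auto
      then consider "fst p < x" "x < fst q" | "x \<in> {fst q..?b}" using x by fastforce
      then show "\<exists>l\<in>fst ` set (p # ws). \<exists>r\<in>fst ` set (p # ws). l < x \<and> x < r \<and>
        affine_between H l r \<and> (\<forall>v\<in>fst ` set (p # ws). v \<le> l \<or> r \<le> v)"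
      proof cases
        case 1
        have "affine_between H (fst p) (fst q)" unfolding affine_between_def using H_left by auto
        moreover have "\<forall>v\<in>fst ` set (p # ws). v \<le> fst p \<or> fst q \<le> v" using F.V_subset by fastforce
        ultimately show ?thesis using 1 ws by (intro bexI[of _ "fst p"] bexI[of _ "fst q"]) auto
      next
        case 2
        then obtain l r where lr: "l \<in> fst ` set ws" "r \<in> fst ` set ws" "l < x" "x < r"
          "affine_between F l r" "\<forall>v\<in>fst ` set ws. v \<le> l \<or> r \<le> v"
          using F.edge_exists[of x] x by auto
        have "fst q \<le> l" using lr(1) F.V_subset by auto
        then have "affine_between H l r"
          using lr(5) H_right unfolding affine_between_def by auto
        moreover have "\<forall>v\<in>fst ` set (p # ws). v \<le> l \<or> r \<le> v"
          using lr(6) \<open>fst q \<le> l\<close> pq by auto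
        ultimately show ?thesis using lr(1-4) by (intro bexI[of _ l] bexI[of _ r]) auto
      qed
    qed
    then show ?case using cons.hyps by auto
  qed
qed

text \<open>If \<open>g\<close> is between \<open>x\<close> and \<open>y\<close>, it is on the same
  edge; if to the right, \<open>los_triangle\<close> applies, if to the left, its mirror image. So a
  visibility region meets each edge in an interval.\<close>

lemma los_between:
  assumes "affine_between F l r" "l \<le> x" "x \<le> z" "z \<le> y" "y \<le> r" "los F g x" "los F g y"
  shows "los F g z"
proof -
  have "{x..y} \<subseteq> {l..r}" using assms by auto
  then have aff: "affine_between F x y" using assms(1) unfolding affine_between_def by blast
  consider "x \<le> g" "g \<le> y" | "y \<le> g" | "g \<le> x" by linarith
  then show ?thesis
  proof cases
    case 1
    then show ?thesis using los_same_edge[OF aff] assms by simp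
  next
    case 2
    then show ?thesis using los_triangle[OF aff, of z g] assms by (simp add: los_commute[of F g])
  next
    case 3
    then have "los (\<lambda>x. F (- x)) (- z) (- g)"
      using los_triangle[OF affine_between_reflect[OF aff], of "- z" "- g"] assms
      by (simp add: los_reflect los_commute[of F g])
    then show ?thesis by (simp add: los_reflect los_commute[of F g])
  qed
qed

section \<open>Visibility regions, their components and extremal points\<close>

context terrain_graph
begin

lemma in_terrain: "p \<in> terrain vs \<longleftrightarrow> fst p \<in> {a..b} \<and> snd p = F (fst p)"
  unfolding graph by (auto simp: image_iff prod_eq_iff)

lemma terrain_eqI: "p \<in> terrain vs \<Longrightarrow> q \<in> terrain vs \<Longrightarrow> fst p = fst q \<Longrightarrow> p = q"
  by (simp add: in_terrain prod_eq_iff)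

lemma graph_point: "x \<in> {a..b} \<Longrightarrow> (x, F x) \<in> terrain vs"
  by (simp add: in_terrain)

lemma in_graph_image: "p \<in> terrain vs \<Longrightarrow> fst p \<in> S \<Longrightarrow> p \<in> (\<lambda>x. (x, F x)) ` S"
  by (rule image_eqI[of _ _ "fst p"]) (simp_all add: in_terrain prod_eq_iff)

lemma vertices_subset: "set vs \<subseteq> terrain vs"
  by (auto simp: terrain_def)

text \<open>A segment between terrain points projects into \<open>{a..b}\<close>, and the terrain
  has exactly one point at each abscissa there; so the quantifier over terrain points in
  \<open>sees\<close> amounts to one comparison with \<open>F\<close>.\<close>

lemma sees_iff_los:
  assumes "p \<in> terrain vs" "q \<in> terrain vs"
  shows "sees vs p q \<longleftrightarrow> los F (fst p) (fst q)"
proof -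
  have seg: "(1 - t) * fst p + t * fst q \<in> {a..b}" if "t \<in> {0..1}" for t
    using convexD[of "{a..b}" "fst p" "fst q" "1 - t" t] assms that by (auto simp: in_terrain)
  have "sees vs p q \<longleftrightarrow> (\<forall>z\<in>closed_segment p q. F (fst z) \<le> snd z)"
  proof -
    have "(\<forall>t\<in>terrain vs. fst t = fst z \<longrightarrow> snd t \<le> snd z) \<longleftrightarrow> F (fst z) \<le> snd z"
      if "z \<in> closed_segment p q" for z
    proof -
      have "fst z \<in> {a..b}" using that seg by (auto simp: closed_segment_def)
      then show ?thesis using graph_point[of "fst z"] by (fastforce simp: in_terrain)
    qed
    then show ?thesis using assms by (simp add: sees_def)
  qed
  also have "\<dots> \<longleftrightarrow> los F (fst p) (fst q)"
    using assms by (simp add: closed_segment_image_interval los_def in_terrain)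
  finally show ?thesis .
qed

lemma in_vis: "g \<in> terrain vs \<Longrightarrow> q \<in> vis vs g \<longleftrightarrow> q \<in> terrain vs \<and> los F (fst g) (fst q)"
  by (simp add: vis_def sees_iff_los cong: conj_cong)

lemma covers_iff:
  assumes "C \<subseteq> terrain vs"
  shows "terrain vs \<subseteq> vis_set vs C \<longleftrightarrow> (\<forall>x\<in>{a..b}. \<exists>c\<in>fst ` C. los F c x)"
proof
  assume cov: "terrain vs \<subseteq> vis_set vs C"
  show "\<forall>x\<in>{a..b}. \<exists>c\<in>fst ` C. los F c x"
  proof
    fix x assume "x \<in> {a..b}"
    then have "(x, F x) \<in> vis_set vs C" using cov graph_point by blast
    then obtain c where "c \<in> C" "(x, F x) \<in> vis vs c" by (auto simp: vis_set_def)
    then show "\<exists>c\<in>fst ` C. los F c x" using in_vis[of c "(x, F x)"] assms by auto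
  qed
next
  assume *: "\<forall>x\<in>{a..b}. \<exists>c\<in>fst ` C. los F c x"
  show "terrain vs \<subseteq> vis_set vs C"
  proof
    fix q assume q: "q \<in> terrain vs"
    then obtain c where "c \<in> C" "los F (fst c) (fst q)" using * unfolding in_terrain by blast
    then show "q \<in> vis_set vs C" using in_vis[of c q] assms q by (auto simp: vis_set_def)
  qed
qed

lemma continuous_graph_map: "S \<subseteq> {a..b} \<Longrightarrow> continuous_on S (\<lambda>x. (x, F x))"
  by (intro continuous_on_Pair continuous_on_id continuous_on_subset[OF continuous])

lemma compact_vis:
  assumes "g \<in> terrain vs"
  shows "compact (vis vs g)"
proof -
  have "vis vs g = (\<lambda>x. (x, F x)) ` {x \<in> {a..b}. los F (fst g) x}"
    using in_vis[OF assms] by (auto simp: in_terrain image_iff prod_eq_iff)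
  moreover have "compact ({a..b} \<inter> {x \<in> {a..b}. los F (fst g) x})"
    using assms by (intro compact_Int_closed closed_los) (auto simp: in_terrain)
  moreover have "{a..b} \<inter> {x \<in> {a..b}. los F (fst g) x} = {x \<in> {a..b}. los F (fst g) x}" by auto
  ultimately show ?thesis
    using compact_continuous_image[OF continuous_graph_map, of "{x \<in> {a..b}. los F (fst g) x}"] by auto
qed

text \<open>By compactness the x-coordinate attains its minimum and maximum on the component of
  \<open>q\<close>; by connectedness the component projects onto an interval. As the terrain is a
  graph, all its points over this interval belong to the component.\<close>

lemma vis_component:
  assumes g: "g \<in> terrain vs" and q: "q \<in> vis vs g"
  obtains p p' where "extremal vs g p" "extremal vs g p'" "fst p \<le> fst q" "fst q \<le> fst p'"
    "\<And>r. r \<in> terrain vs \<Longrightarrow> fst p \<le> fst r \<Longrightarrow> fst r \<le> fst p' \<Longrightarrow> r \<in> vis vs g"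
proof -
  let ?K = "connected_component_set (vis vs g) q"
  have sub: "?K \<subseteq> vis vs g" by (rule connected_component_subset)
  then have subT: "?K \<subseteq> terrain vs" by (auto simp: vis_def)
  have "closed ?K" using compact_vis[OF g] by (intro closed_connected_component compact_imp_closed)
  then have K: "compact ?K" using compact_vis[OF g] sub by (metis compact_Int_closed inf.absorb2)
  have qK: "q \<in> ?K" using q by simp
  have cont: "continuous_on ?K fst" by (intro continuous_intros)
  obtain p where p: "p \<in> ?K" "\<And>r. r \<in> ?K \<Longrightarrow> fst p \<le> fst r"
    using continuous_attains_inf[OF K _ cont] qK by blast
  obtain p' where p': "p' \<in> ?K" "\<And>r. r \<in> ?K \<Longrightarrow> fst r \<le> fst p'"
    using continuous_attains_sup[OF K _ cont] qK by blast
  \<comment> \<open>Extremality of \<open>p\<close> and \<open>p'\<close> refers to their own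
    components, which coincide with that of \<open>q\<close>.\<close>
  have same: "connected_component_set (vis vs g) s = ?K" if "s \<in> ?K" for s
    using connected_component_eq[OF that] by simp
  have "connected (fst ` ?K)" by (intro connected_continuous_image cont connected_connected_component)
  then have ivl: "{fst p..fst p'} \<subseteq> fst ` ?K" using p p' by (intro connected_contains_Icc) auto
  show thesis
  proof
    show "extremal vs g p" unfolding extremal_def same[OF p(1)] using p sub by blast
    show "extremal vs g p'" unfolding extremal_def same[OF p'(1)] using p' sub by blast
    show "fst p \<le> fst q" "fst q \<le> fst p'" using p p' qK by auto
    fix r assume r: "r \<in> terrain vs" "fst p \<le> fst r" "fst r \<le> fst p'"
    then obtain s where s: "s \<in> ?K" "fst r = fst s" using ivl by fastforce
    then have "r = s" using terrain_eqI r subT by blast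
    then show "r \<in> vis vs g" using s sub by blast
  qed
qed

text \<open>By \<open>los_between\<close> the part of the region on one edge is connected, so an
  extremal point inside an edge is leftmost or rightmost in that part. Each edge thus contributes at
  most two extremal points besides the vertices.\<close>

lemma finite_extremal:
  assumes g: "g \<in> terrain vs"
  shows "finite {p. extremal vs g p}"
proof -
  define V where "V = fst ` set vs"
  define strip where "strip = (\<lambda>(l, r). {p \<in> vis vs g. l \<le> fst p \<and> fst p \<le> r})"
  define top where "top = (\<lambda>e. {p \<in> strip e. \<forall>q\<in>strip e. fst q \<le> fst p})"
  define bot where "bot = (\<lambda>e. {p \<in> strip e. \<forall>q\<in>strip e. fst p \<le> fst q})"
  have strip_T: "strip e \<subseteq> terrain vs" for e by (auto simp: strip_def vis_def split: prod.splits)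
  have single: "finite A" if "\<And>x y. x \<in> A \<Longrightarrow> y \<in> A \<Longrightarrow> x = y" for A :: "point set"
  proof (cases "A = {}")
    case False
    then obtain x where "x \<in> A" by blast
    then have "A \<subseteq> {x}" using that by blast
    then show ?thesis using finite_subset by blast
  qed simp
  have "finite (top e)" for e
    using strip_T[of e] by (intro single terrain_eqI) (auto simp: top_def intro: antisym)
  moreover have "finite (bot e)" for e
    using strip_T[of e] by (intro single terrain_eqI) (auto simp: bot_def intro: antisym)
  ultimately have fin: "finite (set vs \<union> (\<Union>e\<in>V \<times> V. top e \<union> bot e))" by (simp add: V_def)
  have "p \<in> set vs \<union> (\<Union>e\<in>V \<times> V. top e \<union> bot e)" if p: "extremal vs g p" for p
  proof (cases "p \<in> set vs")
    case False
    have pv: "p \<in> vis vs g" using p by (simp add: extremal_def)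
    then have pT: "p \<in> terrain vs" by (simp add: vis_def)
    have "fst p \<notin> V"
    proof
      assume "fst p \<in> V"
      then obtain v where "v \<in> set vs" "fst p = fst v" unfolding V_def by blast
      then show False using False terrain_eqI[of p v] pT vertices_subset by auto
    qed
    then obtain l r where lr: "l \<in> V" "r \<in> V" "l < fst p" "fst p < r" "affine_between F l r"
      using edge_exists[of "fst p"] pT unfolding V_def in_terrain by blast
    \<comment> \<open>The arc of the terrain between \<open>s\<close> and \<open>p\<close> is
      connected and, by \<open>los_between\<close>, visible from \<open>g\<close>; so
      \<open>s\<close> is in the component to which the extremality of \<open>p\<close>
      refers.\<close>
    have in_comp: "s \<in> connected_component_set (vis vs g) p" if s: "s \<in> strip (l, r)" for s
    proof -
      let ?I = "{min (fst s) (fst p)..max (fst s) (fst p)}"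
      have sv: "s \<in> vis vs g" "s \<in> terrain vs" using s strip_T by (auto simp: strip_def)
      have range: "?I \<subseteq> {a..b}" using sv pT by (auto simp: in_terrain)
      have "(x, F x) \<in> vis vs g" if x: "x \<in> ?I" for x
      proof -
        have "los F (fst g) (min (fst s) (fst p))" "los F (fst g) (max (fst s) (fst p))"
          using in_vis[OF g] sv pv by (auto simp: min_def max_def)
        then have "los F (fst g) x"
          using los_between[OF lr(5), of "min (fst s) (fst p)" x "max (fst s) (fst p)" "fst g"]
            x s lr by (auto simp: strip_def)
        moreover have "(x, F x) \<in> terrain vs" using graph_point range x by blast
        ultimately show ?thesis using in_vis[OF g] by simp
      qed
      then have "(\<lambda>x. (x, F x)) ` ?I \<subseteq> vis vs g" by blast
      moreover have "connected ((\<lambda>x. (x, F x)) ` ?I)"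
        using range by (intro connected_continuous_image continuous_graph_map) auto
      moreover have "p \<in> (\<lambda>x. (x, F x)) ` ?I" "s \<in> (\<lambda>x. (x, F x)) ` ?I"
        by (rule in_graph_image[OF pT], simp) (rule in_graph_image[OF sv(2)], simp)
      ultimately show ?thesis by (metis connected_component_maximal subsetD)
    qed
    have "p \<in> strip (l, r)" using pv lr by (simp add: strip_def)
    then have "p \<in> top (l, r) \<union> bot (l, r)"
      using p in_comp unfolding extremal_def top_def bot_def by blast
    then show ?thesis using lr by blast
  qed simp
  then show ?thesis by (intro finite_subset[OF subsetI fin]) simp
qed

section \<open>Features of the overlay and their witnesses\<close>

lemma guards_U_subset: "guards_U vs \<subseteq> terrain vs"
  using vertices_subset by (auto simp: guards_U_def extremal_def vis_def)

lemma finite_guards_U: "finite (guards_U vs)"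
  using finite_extremal vertices_subset by (auto simp: guards_U_def)

lemma overlay_endpoints_subset: "overlay_endpoints vs G \<subseteq> terrain vs"
  by (auto simp: overlay_endpoints_def extremal_def vis_def)

lemma finite_overlay_endpoints:
  "finite G \<Longrightarrow> G \<subseteq> terrain vs \<Longrightarrow> finite (overlay_endpoints vs G)"
  using finite_extremal by (auto simp: overlay_endpoints_def)

lemma finite_features:
  assumes "finite G" "G \<subseteq> terrain vs"
  shows "finite (features vs G)"
proof -
  let ?E = "overlay_endpoints vs G"
  have "features vs G \<subseteq> (\<lambda>p. {p}) ` ?E \<union> (\<lambda>(p, q). open_subterrain vs p q) ` (?E \<times> ?E)"
    unfolding features_def by fast
  then show ?thesis
    by (rule finite_subset) (use finite_overlay_endpoints[OF assms] in auto)
qed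

lemma feature_subset: "f \<in> features vs G \<Longrightarrow> f \<subseteq> terrain vs"
  using overlay_endpoints_subset by (auto simp: features_def open_subterrain_def)

text \<open>Every vertex sees itself, so the first and the last vertex, being in \<open>G\<close>,
  contribute end points at both ends of the terrain. Any other point therefore has nearest end
  points on both sides, and these bound its feature.\<close>

lemma feature_exists:
  assumes G: "finite G" "set vs \<subseteq> G" "G \<subseteq> terrain vs" and p: "p \<in> terrain vs"
  obtains f where "f \<in> features vs G" "p \<in> f"
proof (cases "p \<in> overlay_endpoints vs G")
  case True
  then have "{p} \<in> features vs G" unfolding features_def by blast
  then show thesis using that by blast
next
  case False
  let ?E = "overlay_endpoints vs G"
  have E: "finite ?E" using finite_overlay_endpoints G by blast
  have neq: "fst e \<noteq> fst p" if "e \<in> ?E" for e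
    using terrain_eqI[of e p] that p False overlay_endpoints_subset by blast
  have ext: "\<exists>e\<in>?E. \<exists>e'\<in>?E. fst e \<le> fst v \<and> fst v \<le> fst e'" if v: "v \<in> set vs" for v
  proof -
    have vT: "v \<in> terrain vs" using v vertices_subset by blast
    then have "v \<in> vis vs v" using in_vis los_refl by blast
    then obtain e e' where "extremal vs v e" "extremal vs v e'" "fst e \<le> fst v" "fst v \<le> fst e'"
      using vis_component[OF vT] by metis
    moreover have "{s. extremal vs v s} \<subseteq> ?E" using v G(2) unfolding overlay_endpoints_def by blast
    ultimately show ?thesis by blast
  qed
  have "a \<le> fst p" "fst p \<le> b" using p by (auto simp: in_terrain)
  obtain va vb where "va \<in> set vs" "fst va = a" "vb \<in> set vs" "fst vb = b" using ends by force
  then obtain ea eb where ea: "ea \<in> ?E" "fst ea \<le> a" and eb: "eb \<in> ?E" "b \<le> fst eb" using ext by metis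
  define L where "L = {x \<in> fst ` ?E. x < fst p}"
  define R where "R = {x \<in> fst ` ?E. fst p < x}"
  have fin: "finite L" "finite R" using E by (auto simp: L_def R_def)
  have "fst ea \<in> L" "fst eb \<in> R"
    using ea eb neq[of ea] neq[of eb] \<open>a \<le> fst p\<close> \<open>fst p \<le> b\<close> by (auto simp: L_def R_def)
  then have "Max L \<in> L" "Min R \<in> R" using fin by (auto intro: Max_in Min_in)
  then obtain e e' where e: "e \<in> ?E" "fst e = Max L" "fst e < fst p"
    and e': "e' \<in> ?E" "fst e' = Min R" "fst p < fst e'" unfolding L_def R_def by auto
  have "\<not> (\<exists>s\<in>?E. fst e < fst s \<and> fst s < fst e')"
  proof
    assume "\<exists>s\<in>?E. fst e < fst s \<and> fst s < fst e'"
    then obtain s where s: "s \<in> ?E" "Max L < fst s" "fst s < Min R" using e e' by auto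
    then have "fst s \<in> L \<or> fst s \<in> R" using neq[of s] by (auto simp: L_def R_def)
    then show False using s Max_ge[OF fin(1), of "fst s"] Min_le[OF fin(2), of "fst s"] by linarith
  qed
  moreover have "fst e < fst e'" using e e' by simp
  ultimately have "open_subterrain vs e e' \<in> features vs G"
    unfolding features_def using e(1) e'(1) by blast
  moreover have "p \<in> open_subterrain vs e e'" using p e e' by (simp add: open_subterrain_def)
  ultimately show thesis using that by blast
qed

text \<open>The component of \<open>r\<close> in the region of \<open>c\<close> extends between two
  end points of the overlay. No end point lies strictly inside an interval feature, so the component
  contains the whole feature.\<close>

lemma feature_uniform:
  assumes "G \<subseteq> terrain vs" "f \<in> features vs G" "c \<in> G" "r \<in> f" "r \<in> vis vs c"
  shows "f \<subseteq> vis vs c"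
proof -
  let ?E = "overlay_endpoints vs G"
  consider "f = {r}" | p q where "f = open_subterrain vs p q"
      "\<And>s. s \<in> ?E \<Longrightarrow> \<not> (fst p < fst s \<and> fst s < fst q)"
    using assms(2,4) unfolding features_def by blast
  then show ?thesis
  proof cases
    case 1
    then show ?thesis using assms(5) by simp
  next
    case 2
    obtain s s' where s: "extremal vs c s" "extremal vs c s'" "fst s \<le> fst r" "fst r \<le> fst s'"
      "\<And>t. t \<in> terrain vs \<Longrightarrow> fst s \<le> fst t \<Longrightarrow> fst t \<le> fst s' \<Longrightarrow> t \<in> vis vs c"
      using vis_component[OF _ assms(5)] assms(1,3) by blast
    have "s \<in> ?E" "s' \<in> ?E" using s assms(3) by (auto simp: overlay_endpoints_def)
    then have "fst s \<le> fst p" "fst q \<le> fst s'"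
      using 2(2)[of s] 2(2)[of s'] s(3,4) assms(4) unfolding 2(1) open_subterrain_def by auto
    then show ?thesis unfolding 2(1) open_subterrain_def using s(5) by auto
  qed
qed

lemma minimal_feature_below:
  assumes "finite G" "G \<subseteq> terrain vs" "f \<in> features vs G"
  obtains f' where "f' \<in> minimal_features vs G" "feature_guards vs G f' \<subseteq> feature_guards vs G f"
proof -
  \<comment> \<open>Minimality is sought among the finitely many guard sets rather than the
    features, since different features may have the same guards.\<close>
  obtain f' where f': "f' \<in> features vs G" "feature_guards vs G f' \<subseteq> feature_guards vs G f"
    and min: "\<And>h. h \<in> features vs G \<Longrightarrow> feature_guards vs G h \<subseteq> feature_guards vs G f' \<Longrightarrow>
      feature_guards vs G f' = feature_guards vs G h"
    using finite_has_minimal2[OF finite_imageI[OF finite_features[OF assms(1,2)]] imageI[OF assms(3)],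
      of "feature_guards vs G"] by auto
  then have "f' \<in> minimal_features vs G" unfolding minimal_features_def by auto
  then show thesis using that f'(2) by blast
qed

lemma witnesses_cover_terrain:
  assumes G: "finite G" "set vs \<subseteq> G" "G \<subseteq> terrain vs"
    and w: "\<And>f. f \<in> minimal_features vs G \<Longrightarrow> w f \<in> f"
    and C: "C \<subseteq> G" "witnesses vs G w \<subseteq> vis_set vs C"
  shows "terrain vs \<subseteq> vis_set vs C"
proof
  fix p assume "p \<in> terrain vs"
  then obtain f where f: "f \<in> features vs G" "p \<in> f" using feature_exists[OF G] by blast
  obtain f' where f': "f' \<in> minimal_features vs G" "feature_guards vs G f' \<subseteq> feature_guards vs G f"
    using minimal_feature_below[OF G(1,3) f(1)] by blast
  have "w f' \<in> vis_set vs C" using C(2) f'(1) by (auto simp: witnesses_def)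
  then obtain c where c: "c \<in> C" "w f' \<in> vis vs c" by (auto simp: vis_set_def)
  then have "f' \<subseteq> vis vs c"
    using feature_uniform[OF G(3) _ _ w[OF f'(1)]] f'(1) C(1) unfolding minimal_features_def by blast
  then have "c \<in> feature_guards vs G f" using f'(2) c C(1) by (auto simp: feature_guards_def)
  then show "p \<in> vis_set vs C" using f(2) c(1) by (auto simp: feature_guards_def vis_set_def)
qed

section \<open>Moving an arbitrary cover into \<open>guards_U\<close>\<close>

text \<open>The right target of \<open>guard_shift\<close> is the vertex \<open>R\<close>. The left
  target \<open>u\<close> is the rightmost point among \<open>L\<close>, which keeps
  \<open>u\<close> on the edge, and the left ends of those components of vertex regions that contain
  \<open>g\<close>. From such a left end up to \<open>g\<close> the vertex sees everything, in
  particular \<open>u\<close>.\<close>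

lemma replace_guard:
  assumes C: "C \<subseteq> terrain vs" "terrain vs \<subseteq> vis_set vs C" and g: "g \<in> C" "g \<notin> guards_U vs"
  obtains u where "u \<in> guards_U vs" "terrain vs \<subseteq> vis_set vs (insert u (C - {g}))"
proof -
  have gT: "g \<in> terrain vs" using C g by blast
  have gU: "u \<in> guards_U vs \<Longrightarrow> fst u \<noteq> fst g" for u
    using terrain_eqI[of u g] g gT guards_U_subset by blast
  have "fst g \<notin> fst ` set vs" using gU by (force simp: guards_U_def)
  then obtain L R where LR: "L \<in> set vs" "R \<in> set vs" "fst L < fst g" "fst g < fst R"
    "affine_between F (fst L) (fst R)"
    using edge_exists[of "fst g"] gT unfolding in_terrain by blast
  define S where "S = {v \<in> set vs. los F (fst v) (fst g)}"
  have "\<exists>p. extremal vs v p \<and> fst p \<le> fst g \<and>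
    (\<forall>r\<in>terrain vs. fst p \<le> fst r \<and> fst r \<le> fst g \<longrightarrow> r \<in> vis vs v)" if v: "v \<in> S" for v
  proof -
    have vT: "v \<in> terrain vs" using v vertices_subset by (auto simp: S_def)
    then have "g \<in> vis vs v" using v gT in_vis by (simp add: S_def)
    then obtain p p' where "extremal vs v p" "extremal vs v p'" "fst p \<le> fst g" "fst g \<le> fst p'"
      "\<And>r. r \<in> terrain vs \<Longrightarrow> fst p \<le> fst r \<Longrightarrow> fst r \<le> fst p' \<Longrightarrow> r \<in> vis vs v"
      using vis_component[OF vT] by blast
    then show ?thesis by (intro exI[of _ p]) auto
  qed
  then obtain P where P: "\<And>v. v \<in> S \<Longrightarrow> extremal vs v (P v)" "\<And>v. v \<in> S \<Longrightarrow> fst (P v) \<le> fst g"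
    "\<And>v r. v \<in> S \<Longrightarrow> r \<in> terrain vs \<Longrightarrow> fst (P v) \<le> fst r \<Longrightarrow> fst r \<le> fst g \<Longrightarrow> r \<in> vis vs v"
    by metis
  have fin: "finite (insert (fst L) ((fst \<circ> P) ` S))" by (simp add: S_def)
  define x where "x = Max (insert (fst L) ((fst \<circ> P) ` S))"
  have "x \<in> insert (fst L) ((fst \<circ> P) ` S)" unfolding x_def by (rule Max_in[OF fin]) simp
  then have "x \<in> fst ` insert L (P ` S)" by (simp add: image_comp)
  then obtain u where "x = fst u" "u \<in> insert L (P ` S)" by (rule imageE)
  moreover have "insert L (P ` S) \<subseteq> guards_U vs"
    using P(1) LR unfolding guards_U_def S_def by blast
  ultimately have u: "u \<in> guards_U vs" "fst u = x" by auto
  have xg: "x \<le> fst g" unfolding x_def using LR P(2) fin by simp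
  have Lx: "fst L \<le> x" unfolding x_def using fin by simp
  have Px: "fst (P v) \<le> x" if "v \<in> S" for v unfolding x_def using fin that by (intro Max_ge) auto
  have vert: "los F v (fst u)" if v: "v \<in> fst ` set vs" "los F v (fst g)" for v
  proof -
    obtain s where s: "s \<in> set vs" "v = fst s" using v by blast
    then have sS: "s \<in> S" using v by (simp add: S_def)
    then have "u \<in> vis vs s" using P(3) Px u xg guards_U_subset by blast
    then show ?thesis using in_vis[of s u] s vertices_subset by auto
  qed
  have diff: "fst ` C - {fst g} \<subseteq> fst ` (C - {g})" by auto
  have cov: "\<exists>c\<in>fst ` C. los F c y" if "y \<in> {a..b}" for y using covers_iff[OF C(1)] C(2) that by blast
  have "(\<forall>y\<in>{a..b}. \<exists>c\<in>insert (fst u) (fst ` C - {fst g}). los F c y) \<or>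
        (\<forall>y\<in>{a..b}. \<exists>c\<in>insert (fst R) (fst ` C - {fst g}). los F c y)"
    using guard_shift[OF cov, of "fst g" "fst L" "fst R" "fst u" "fst R"] LR g u xg Lx vert by auto
  moreover have "R \<in> guards_U vs" using LR by (simp add: guards_U_def)
  ultimately obtain t where t: "t \<in> guards_U vs"
    "\<forall>y\<in>{a..b}. \<exists>c\<in>insert (fst t) (fst ` C - {fst g}). los F c y" using u by blast
  then have "\<forall>y\<in>{a..b}. \<exists>c\<in>fst ` (insert t (C - {g})). los F c y" using diff by blast
  moreover have "insert t (C - {g}) \<subseteq> terrain vs" using t C guards_U_subset by blast
  ultimately have "terrain vs \<subseteq> vis_set vs (insert t (C - {g}))" using covers_iff by blast
  then show thesis using that t by blast
qed

text \<open>Each use of \<open>replace_guard\<close> lowers the number of guards outside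
  \<open>guards_U\<close>, on which the induction runs. The new guard may already be present, so the
  cardinality can drop.\<close>

lemma cover_by_guards_U:
  assumes "finite C" "C \<subseteq> terrain vs" "terrain vs \<subseteq> vis_set vs C"
  shows "\<exists>C'. finite C' \<and> C' \<subseteq> guards_U vs \<and> card C' \<le> card C \<and> terrain vs \<subseteq> vis_set vs C'"
  using assms
proof (induction "card (C - guards_U vs)" arbitrary: C rule: less_induct)
  case less
  show ?case
  proof (cases "C \<subseteq> guards_U vs")
    case True
    then show ?thesis using less.prems by blast
  next
    case False
    then obtain g where g: "g \<in> C" "g \<notin> guards_U vs" by blast
    obtain u where u: "u \<in> guards_U vs" "terrain vs \<subseteq> vis_set vs (insert u (C - {g}))"
      using replace_guard[OF less.prems(2,3) g] by blast
    let ?D = "insert u (C - {g})"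
    have "?D - guards_U vs = (C - guards_U vs) - {g}" using u(1) by auto
    then have "card (?D - guards_U vs) < card (C - guards_U vs)"
      using g less.prems(1) by (simp only:) (rule card_Diff1_less; simp)
    moreover have "?D \<subseteq> terrain vs" using u less.prems(2) guards_U_subset by blast
    ultimately obtain C' where C': "finite C'" "C' \<subseteq> guards_U vs" "card C' \<le> card ?D"
      "terrain vs \<subseteq> vis_set vs C'" using less.hyps[of ?D] less.prems(1) u by auto
    have "card ?D \<le> Suc (card (C - {g}))" by (rule card_insert_le_m1) simp_all
    also have "\<dots> = card C" by (rule card_Suc_Diff1[OF less.prems(1) g(1)])
    finally show ?thesis using C' by (meson order_trans)
  qed
qed

end

section \<open>Passage to optimal solutions\<close>

lemma OPT_le: "feasible vs G W C \<Longrightarrow> finite C \<Longrightarrow> OPT vs G W \<le> card C"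
  unfolding OPT_def by (rule Least_le) blast

lemma OPT_attained:
  assumes "feasible vs G W C" "finite C"
  obtains D where "feasible vs G W D" "finite D" "card D = OPT vs G W"
proof -
  have "\<exists>D. feasible vs G W D \<and> finite D \<and> card D = OPT vs G W"
    unfolding OPT_def by (rule LeastI_ex) (use assms in blast)
  then show thesis using that by blast
qed

theorem theorem16:
  fixes vs :: "point list"
    and w :: "point set \<Rightarrow> point"
    and C :: "point set"
  assumes "is_terrain vs"
    and "\<And>f. f \<in> minimal_features vs (guards_U vs) \<Longrightarrow> w f \<in> f"
    and "optimal vs (guards_U vs) (witnesses vs (guards_U vs) w) C"
  shows "optimal vs (terrain vs) (terrain vs) C \<and>
         OPT vs (terrain vs) (terrain vs) = card C \<and>
         card C = OPT vs (guards_U vs) (witnesses vs (guards_U vs) w)"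
proof -
  let ?T = "terrain vs" and ?U = "guards_U vs"
  let ?W = "witnesses vs ?U w"
  obtain F where "terrain_graph F vs (fst (hd vs)) (fst (last vs))"
    using terrain_graph_exists[OF assms(1)] by blast
  then interpret terrain_graph F vs "fst (hd vs)" "fst (last vs)" .
  have C: "C \<subseteq> ?U" "?W \<subseteq> vis_set vs C" "finite C" "card C = OPT vs ?U ?W"
    using assms(3) by (auto simp: optimal_def feasible_def)
  have "set vs \<subseteq> ?U" by (simp add: guards_U_def)
  then have "?T \<subseteq> vis_set vs C"
    using witnesses_cover_terrain[OF finite_guards_U _ guards_U_subset assms(2) C(1,2)] by blast
  then have feas: "feasible vs ?T ?T C" using C(1) guards_U_subset by (auto simp: feasible_def)
  obtain D where D: "feasible vs ?T ?T D" "finite D" "card D = OPT vs ?T ?T"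
    using OPT_attained[OF feas C(3)] .
  then obtain D' where D': "finite D'" "D' \<subseteq> ?U" "card D' \<le> card D" "?T \<subseteq> vis_set vs D'"
    using cover_by_guards_U[OF D(2)] D(1) unfolding feasible_def by blast
  \<comment> \<open>Witnesses lie on the terrain, so the cover \<open>D'\<close> also solves the
    discrete problem; this gives \<open>card C \<le> card D'\<close> and thus
    \<open>card C \<le> card D\<close>.\<close>
  have "?W \<subseteq> ?T"
    using assms(2) feature_subset unfolding witnesses_def minimal_features_def by blast
  then have "feasible vs ?U ?W D'" using D' by (auto simp: feasible_def)
  then have "card C \<le> OPT vs ?T ?T" using OPT_le D' D(3) C(4) by fastforce
  then have "OPT vs ?T ?T = card C" using OPT_le[OF feas C(3)] by simp
  then show ?thesis using feas C by (simp add: optimal_def)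
qed

end
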